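(* Let $E$ be a principal ideal domain, $f_1,f_2\in E[x]$ with $\gcd(f_1,f_2)=1$, $R_i=E[x]/(f_i)$, $N_i\subseteq R_i$ finite, and suppose $R_{12}=E[x]/(f_1,f_2)$ is finite. Assume: (i) $(R_i,X,N_i)$ is an irredundant digit system for $i=1,2$; (ii) there exists $\tilde d\in E[x]$ with $d\equiv\tilde d\pmod{(f_1,f_2)}$ for all $d\in N_1\cup N_2$; (iii) $(R_i,X,N_i)$ has the Finite Expansion Property with zero expansion length $L_i$ for $i=1,2$; (iv) $\gcd(L_1,L_2)=S(\tilde d)$, with $\tilde d$ denoting its image in $R_{12}$. Then $\tilde d$ is invertible in $R_{12}$ and $S(\tilde d)=|R_{12}|$. If in addition $E=\mathbb{Z}$ and the leading coefficients of $f_1$ and $f_2$ are coprime, then $S(\tilde d)=|\mathrm{Res}(f_1,f_2)|$; and if moreover $f_1=x-a$ for some $a\in\mathbb{Z}$, then $a\equiv1\pmod p$ for every prime $p$ dividing $f_2(a)$, and $a\equiv1\pmod4$ if $4$ divides $f_2(a)$.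
   Context: A digit system is a triple $(V,\phi,D)$ with $V$ an abelian group, $\phi$ an endomorphism with $V/\phi(V)$ finite, $D\subseteq V$ finite meeting every coset of $\phi(V)$; irredundant if $D$ has exactly one element in each coset; Finite Expansion Property if every $v\in V$ equals $\sum_{i=0}^\ell\phi^i(d_i)$ with $d_i\in D$. A zero expansion is a sequence $(d_0,\ldots,d_\ell)$, $\ell\ge0$, of digits with $\sum\phi^i(d_i)=0$, of length $\ell+1$; the zero expansion length is the length of a shortest one. $X$ is multiplication by the residue class of $x$; $(f_1,f_2)$ is the ideal of $E[x]$ generated by $f_1,f_2$. For $d\in R_{12}$, $s_i(d)=d\sum_{j=0}^iX^j$ and $S(d)$ is the period length of $(s_i(d))_{i\ge0}$. $\mathrm{Res}$ is the resultant. *)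

theory Defs
  imports
    "HOL-Algebra.QuotRing"
    "HOL-Algebra.Ring_Divisibility"
    "HOL-Algebra.Algebraic_Closure_Type"
    "HOL-Computational_Algebra.Computational_Algebra"
    "HOL-Number_Theory.Cong"
    "Subresultants.Resultant_Prelim"
begin

section \<open>Digit systems\<close>

text \<open>An abelian group \<open>V\<close> is given as a ring record of which only the additive part
  (\<open>carrier\<close>, \<open>add\<close>, \<open>zero\<close>) is used.\<close>

definition digit_system ::
  "('v, 'm) ring_scheme \<Rightarrow> ('v \<Rightarrow> 'v) \<Rightarrow> 'v set \<Rightarrow> bool" where
  "digit_system V \<phi> D \<longleftrightarrow>
     abelian_group_hom V V \<phi> \<and>
     finite (a_rcosets\<^bsub>V\<^esub> (\<phi> ` carrier V)) \<and>
     D \<subseteq> carrier V \<and> finite D \<and>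
     (\<forall>C \<in> a_rcosets\<^bsub>V\<^esub> (\<phi> ` carrier V). C \<inter> D \<noteq> {})"

definition irredundant_digit_system ::
  "('v, 'm) ring_scheme \<Rightarrow> ('v \<Rightarrow> 'v) \<Rightarrow> 'v set \<Rightarrow> bool" where
  "irredundant_digit_system V \<phi> D \<longleftrightarrow>
     digit_system V \<phi> D \<and>
     (\<forall>C \<in> a_rcosets\<^bsub>V\<^esub> (\<phi> ` carrier V). \<exists>!d. d \<in> C \<inter> D)"

text \<open>The list \<open>[d\<^sub>0, \<dots>, d\<^sub>l]\<close> of length \<open>l + 1 \<ge> 1\<close> encodes the digit sequence
  \<open>(d\<^sub>0, \<dots>, d\<^sub>l)\<close>; the empty sum is not an expansion.\<close>

definition expansion_of ::
  "('v, 'm) ring_scheme \<Rightarrow> ('v \<Rightarrow> 'v) \<Rightarrow> 'v set \<Rightarrow> 'v \<Rightarrow> 'v list \<Rightarrow> bool" where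
  "expansion_of V \<phi> D v ds \<longleftrightarrow>
     ds \<noteq> [] \<and> set ds \<subseteq> D \<and>
     (\<Oplus>\<^bsub>V\<^esub> i \<in> {..<length ds}. (\<phi> ^^ i) (ds ! i)) = v"

definition finite_expansion_property ::
  "('v, 'm) ring_scheme \<Rightarrow> ('v \<Rightarrow> 'v) \<Rightarrow> 'v set \<Rightarrow> bool" where
  "finite_expansion_property V \<phi> D \<longleftrightarrow>
     (\<forall>v \<in> carrier V. \<exists>ds. expansion_of V \<phi> D v ds)"

definition zero_expansion_length ::
  "('v, 'm) ring_scheme \<Rightarrow> ('v \<Rightarrow> 'v) \<Rightarrow> 'v set \<Rightarrow> nat" where
  "zero_expansion_length V \<phi> D =
     (LEAST n. \<exists>ds. expansion_of V \<phi> D \<zero>\<^bsub>V\<^esub> ds \<and> length ds = n)"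


section \<open>Residue class rings of \<open>E[x]\<close>\<close>

text \<open>\<open>E\<close> is the carrier of the type \<open>'e\<close>, and a residue class ring is the quotient of
  \<open>'e poly\<close>, regarded as a ring record, by the ideal generated by a set \<open>F\<close>. Its
  elements are cosets, i.e. sets of polynomials.\<close>

definition quot_ring :: "'e::idom poly set \<Rightarrow> 'e poly set ring" where
  "quot_ring F = ring_of_type_algebra Quot (genideal ring_of_type_algebra F)"

definition residue_class :: "'e::idom poly set \<Rightarrow> 'e poly \<Rightarrow> 'e poly set" where
  "residue_class F g = genideal ring_of_type_algebra F +>\<^bsub>ring_of_type_algebra\<^esub> g"

definition mult_X :: "'e::idom poly set \<Rightarrow> 'e poly set \<Rightarrow> 'e poly set" where
  "mult_X F v = residue_class F [:0, 1:] \<otimes>\<^bsub>quot_ring F\<^esub> v"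

definition s_seq :: "'e::idom poly set \<Rightarrow> 'e poly set \<Rightarrow> nat \<Rightarrow> 'e poly set" where
  "s_seq F d i =
     d \<otimes>\<^bsub>quot_ring F\<^esub>
       (\<Oplus>\<^bsub>quot_ring F\<^esub> j \<in> {..i}. residue_class F [:0, 1:] [^]\<^bsub>quot_ring F\<^esub> j)"

text \<open>A sequence with values in a finite ring that is generated by iterating a map is
  in general only ultimately periodic, so a preperiod is allowed.\<close>

definition period_length :: "(nat \<Rightarrow> 'b) \<Rightarrow> nat" where
  "period_length s = (LEAST p. p > 0 \<and> (\<exists>m. \<forall>i\<ge>m. s (i + p) = s i))"

definition S_period :: "'e::idom poly set \<Rightarrow> 'e poly set \<Rightarrow> nat" where
  "S_period F d = period_length (s_seq F d)"


section \<open>Two digit systems sharing their digits modulo \<open>(f\<^sub>1, f\<^sub>2)\<close>\<close>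

text \<open>The second conjunct is \<open>gcd(f\<^sub>1, f\<^sub>2) = 1\<close>, i.e. \<open>coprime f1 f2\<close> written out: the
  library constant needs a division operation on \<open>'e poly\<close>. A digit
  \<open>d \<in> N\<^sub>1 \<union> N\<^sub>2\<close> is a coset of \<open>(f\<^sub>1)\<close> or \<open>(f\<^sub>2)\<close>; it is congruent to
  \<open>dt\<close> modulo \<open>(f\<^sub>1, f\<^sub>2)\<close> if all its representatives are.\<close>

definition shared_digits_setting ::
  "'e::idom poly \<Rightarrow> 'e poly \<Rightarrow> 'e poly set set \<Rightarrow> 'e poly set set \<Rightarrow> 'e poly \<Rightarrow> bool" where
  "shared_digits_setting f1 f2 N1 N2 dt \<longleftrightarrow>
     principal_domain (ring_of_type_algebra :: 'e ring) \<and>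
     (\<forall>h. h dvd f1 \<longrightarrow> h dvd f2 \<longrightarrow> h dvd 1) \<and>
     finite (carrier (quot_ring {f1, f2})) \<and>
     irredundant_digit_system (quot_ring {f1}) (mult_X {f1}) N1 \<and>
     irredundant_digit_system (quot_ring {f2}) (mult_X {f2}) N2 \<and>
     (\<forall>d \<in> N1 \<union> N2. \<forall>g \<in> d. g - dt \<in> genideal ring_of_type_algebra {f1, f2}) \<and>
     finite_expansion_property (quot_ring {f1}) (mult_X {f1}) N1 \<and>
     finite_expansion_property (quot_ring {f2}) (mult_X {f2}) N2 \<and>
     gcd (zero_expansion_length (quot_ring {f1}) (mult_X {f1}) N1)
         (zero_expansion_length (quot_ring {f2}) (mult_X {f2}) N2)
       = S_period {f1, f2} (residue_class {f1, f2} dt)"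

end

theory Submission
  imports Defs
begin

text \<open>Modulo \<open>(f\<^sub>1, f\<^sub>2)\<close> all digits collapse to \<open>dt\<close>, so the value of a digit expansion of
  length \<open>i + 1\<close> is \<open>s\<^sub>i(dt)\<close>. By the Finite Expansion Property every element of \<open>R\<^sub>1\<^sub>2\<close> therefore
  occurs in the sequence \<open>s\<close>. In particular \<open>1\<close> occurs, so \<open>dt\<close> is a unit; and \<open>0\<close> occurs, so
  the recursion \<open>s \<mapsto> dt + X s\<close> comes back to \<open>s\<^sub>0\<close>. The sequence is then purely periodic and runs
  through all of \<open>R\<^sub>1\<^sub>2\<close> once per period.

  Over the integers, if the leading coefficients are coprime, \<open>R\<^sub>1\<^sub>2\<close> is the quotient of the
  polynomials of degree less than \<open>deg f\<^sub>1 + deg f\<^sub>2\<close> by the lattice spanned by the rows of the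
  Sylvester matrix. This lattice has a triangular basis; the product of its diagonal counts the
  residue classes, and it agrees with the Sylvester determinant up to sign because the two bases
  generate each other.

  If \<open>f\<^sub>1 = x - a\<close>, evaluation at \<open>a\<close> shows that the numbers \<open>dt(a) (1 + a + \<dots> + a\<^sup>i)\<close> represent
  all residues modulo each divisor of \<open>f\<^sub>2(a)\<close>, as for a linear congruential generator of full
  period.\<close>

section \<open>Residue class rings\<close>

abbreviation poly_ideal :: "'e::idom poly set \<Rightarrow> 'e poly set" where
  "poly_ideal F \<equiv> genideal ring_of_type_algebra F"

context
  fixes F :: "'e::idom poly set"
begin

interpretation R: cring "ring_of_type_algebra :: 'e poly ring"
  by (rule cring_from_type_algebra)

interpretation I: ideal "poly_ideal F" "ring_of_type_algebra :: 'e poly ring"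
  by (rule R.genideal_ideal) (simp add: ring_of_type_algebra_def)

interpretation Q: cring "quot_ring F"
  unfolding quot_ring_def by (rule I.quotient_is_cring) (rule R.is_cring)

interpretation h: ring_hom_cring "ring_of_type_algebra :: 'e poly ring" "quot_ring F" "residue_class F"
  using I.rcos_ring_hom_cring[OF R.is_cring]
  by (simp add: quot_ring_def residue_class_def[abs_def])

lemma cring_quot_ring: "cring (quot_ring F)"
  by (rule Q.is_cring)

lemma generator_in_poly_ideal: "f \<in> F \<Longrightarrow> f \<in> poly_ideal F"
  using R.genideal_self[of F] by (auto simp: ring_of_type_algebra_def)

lemma poly_ideal_zero: "0 \<in> poly_ideal F"
  using I.zero_closed by (simp add: ring_of_type_algebra_def)

lemma poly_ideal_add: "x \<in> poly_ideal F \<Longrightarrow> y \<in> poly_ideal F \<Longrightarrow> x + y \<in> poly_ideal F"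
  using I.a_closed by (simp add: ring_of_type_algebra_def)

lemma poly_ideal_mult: "y \<in> poly_ideal F \<Longrightarrow> x * y \<in> poly_ideal F"
  using I.I_l_closed[of y x] by (simp add: ring_of_type_algebra_def)

lemma poly_ideal_uminus: "x \<in> poly_ideal F \<Longrightarrow> - x \<in> poly_ideal F"
  using poly_ideal_mult[of x "-1"] by simp

lemma poly_ideal_diff: "x \<in> poly_ideal F \<Longrightarrow> y \<in> poly_ideal F \<Longrightarrow> x - y \<in> poly_ideal F"
  using poly_ideal_add[OF _ poly_ideal_uminus, of x y] by simp

lemma poly_ideal_sum:
  "(\<And>i. i \<in> A \<Longrightarrow> g i \<in> poly_ideal F) \<Longrightarrow> sum g A \<in> poly_ideal F"
  by (induction A rule: infinite_finite_induct) (auto intro: poly_ideal_zero poly_ideal_add)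

lemma poly_ideal_minimal:
  assumes "0 \<in> J" "F \<subseteq> J" and add: "\<And>x y. x \<in> J \<Longrightarrow> y \<in> J \<Longrightarrow> x + y \<in> J"
    and mult: "\<And>x y. y \<in> J \<Longrightarrow> x * y \<in> J"
  shows "poly_ideal F \<subseteq> J"
proof (rule R.genideal_minimal)
  have "- x \<in> J" if "x \<in> J" for x
    using mult[OF that, of "-1"] by simp
  \<comment> \<open>The ring record takes its additive inverse from an abstract group, so that
    inverse is first identified with the usual minus of polynomials.\<close>
  moreover have "x + inv\<^bsub>\<lparr>carrier = UNIV, monoid.mult = (+), one = 0\<rparr>\<^esub> x = 0" for x :: "'e poly"
    using R.add.r_inv[of x] by (simp add: ring_of_type_algebra_def a_inv_def)
  then have "inv\<^bsub>\<lparr>carrier = UNIV, monoid.mult = (+), one = 0\<rparr>\<^esub> x = - x" for x :: "'e poly"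
    using add_eq_0_iff by auto
  ultimately show "ideal J (ring_of_type_algebra :: 'e poly ring)"
    using assms mult
    by (intro idealI subgroup.intro R.ring_axioms)
       (auto simp: ring_of_type_algebra_def mult.commute)
qed (use assms in simp)

lemma mem_residue_class_iff: "h \<in> residue_class F g \<longleftrightarrow> h - g \<in> poly_ideal F"
  by (force simp: residue_class_def a_r_coset_def' ring_of_type_algebra_def
      intro: bexI[of _ "h - g"])

lemma residue_class_eq_iff: "residue_class F g = residue_class F h \<longleftrightarrow> g - h \<in> poly_ideal F"
proof
  assume "residue_class F g = residue_class F h"
  moreover have "g \<in> residue_class F g"
    by (simp add: mem_residue_class_iff poly_ideal_zero)
  ultimately show "g - h \<in> poly_ideal F"
    by (simp add: mem_residue_class_iff)
next
  assume *: "g - h \<in> poly_ideal F"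
  have "k - g \<in> poly_ideal F \<longleftrightarrow> k - h \<in> poly_ideal F" for k
    using poly_ideal_add[OF _ *, of "k - g"] poly_ideal_diff[OF _ *, of "k - h"] by auto
  then show "residue_class F g = residue_class F h"
    by (auto simp: mem_residue_class_iff)
qed

lemma carrier_quot_ring: "carrier (quot_ring F) = range (residue_class F)"
  by (auto simp: quot_ring_def FactRing_def A_RCOSETS_def' residue_class_def ring_of_type_algebra_def)

lemma residue_class_mult:
  "residue_class F g \<otimes>\<^bsub>quot_ring F\<^esub> residue_class F h = residue_class F (g * h)"
  using h.hom_mult[of g h] by (simp add: ring_of_type_algebra_def)

lemma residue_class_add:
  "residue_class F g \<oplus>\<^bsub>quot_ring F\<^esub> residue_class F h = residue_class F (g + h)"
  using h.hom_add[of g h] by (simp add: ring_of_type_algebra_def)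

lemma residue_class_one: "\<one>\<^bsub>quot_ring F\<^esub> = residue_class F 1"
  using h.hom_one by (simp add: ring_of_type_algebra_def)

lemma residue_class_zero: "\<zero>\<^bsub>quot_ring F\<^esub> = residue_class F 0"
  using h.hom_zero by (simp add: ring_of_type_algebra_def)

lemma residue_class_power: "residue_class F g [^]\<^bsub>quot_ring F\<^esub> (n::nat) = residue_class F (g ^ n)"
  by (induction n) (simp_all add: residue_class_one residue_class_mult mult.commute)

lemma residue_class_sum:
  "finite A \<Longrightarrow> (\<Oplus>\<^bsub>quot_ring F\<^esub> i \<in> A. residue_class F (g i)) = residue_class F (sum g A)"
  by (induction A rule: finite_induct)
     (simp_all add: residue_class_zero residue_class_add carrier_quot_ring)

lemma mult_X_funpow: "(mult_X F ^^ n) (residue_class F g) = residue_class F ([:0, 1:] ^ n * g)"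
  by (induction n) (simp_all add: mult_X_def residue_class_mult mult.assoc)

lemma s_seq_residue_class:
  "s_seq F (residue_class F g) i = residue_class F (g * (\<Sum>j\<le>i. [:0, 1:] ^ j))"
  by (simp add: s_seq_def residue_class_power residue_class_sum residue_class_mult)

end

lemma poly_ideal_pair:
  "poly_ideal {f1, f2} = {u * f1 + v * f2 | u v. True}" for f1 f2 :: "'e::idom poly"
proof
  show "poly_ideal {f1, f2} \<subseteq> {u * f1 + v * f2 | u v. True}"
  proof (rule poly_ideal_minimal)
    show "0 \<in> {u * f1 + v * f2 | u v. True}"
      by (auto intro: exI[of _ 0])
    have "f1 = 1 * f1 + 0 * f2" "f2 = 0 * f1 + 1 * f2"
      by simp_all
    then show "{f1, f2} \<subseteq> {u * f1 + v * f2 | u v. True}"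
      by blast
  next
    fix x y assume "x \<in> {u * f1 + v * f2 | u v. True}" "y \<in> {u * f1 + v * f2 | u v. True}"
    then obtain u v u' v' where "x = u * f1 + v * f2" "y = u' * f1 + v' * f2"
      by auto
    then have "x + y = (u + u') * f1 + (v + v') * f2"
      by (simp add: algebra_simps)
    then show "x + y \<in> {u * f1 + v * f2 | u v. True}"
      by blast
  next
    fix x y assume "y \<in> {u * f1 + v * f2 | u v. True}"
    then obtain u v where "y = u * f1 + v * f2"
      by auto
    then have "x * y = (x * u) * f1 + (x * v) * f2"
      by (simp add: algebra_simps)
    then show "x * y \<in> {u * f1 + v * f2 | u v. True}"
      by blast
  qed
  show "{u * f1 + v * f2 | u v. True} \<subseteq> poly_ideal {f1, f2}"
    using generator_in_poly_ideal[of _ "{f1, f2}"] by (auto intro!: poly_ideal_add poly_ideal_mult)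
qed

lemma poly_ideal_mono: "F \<subseteq> G \<Longrightarrow> poly_ideal F \<subseteq> poly_ideal G"
  by (intro poly_ideal_minimal)
     (auto intro: poly_ideal_zero poly_ideal_add poly_ideal_mult generator_in_poly_ideal)

section \<open>Periods\<close>

text \<open>The value \<open>s k = c\<close> with \<open>G c = s 0\<close> rules out a preperiod.\<close>

lemma period_length_iterate:
  fixes s :: "nat \<Rightarrow> 'a"
  assumes step: "\<And>i. s (Suc i) = G (s i)" and "s k = c" "G c = s 0"
  shows "period_length s = card (range s)"
proof -
  define P where "P p \<longleftrightarrow> p > 0 \<and> (\<exists>m. \<forall>i\<ge>m. s (i + p) = s i)" for p
  have shift: "s (i + n) = s (j + n)" if "s i = s j" for i j n
    using that by (induction n) (simp_all add: step)
  \<comment> \<open>The value following \<open>c\<close> is \<open>s 0\<close>, so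
    \<open>Suc k\<close> is a period valid from index 0 on.\<close>
  define q where "q = Suc k"
  have q: "s (i + q * m) = s i" for i m
  proof (induction m)
    case (Suc m)
    have "s (q + (i + q * m)) = s (0 + (i + q * m))"
      by (intro shift) (simp add: q_def step assms)
    with Suc show ?case
      by (simp add: algebra_simps)
  qed simp
  define p where "p = period_length s"
  have "P q"
    using q[of _ 1] by (auto simp: P_def q_def)
  then have "P p"
    unfolding p_def period_length_def P_def by (rule LeastI)
  then obtain m where "p > 0" and m: "\<And>i. i \<ge> m \<Longrightarrow> s (i + p) = s i"
    by (auto simp: P_def)
  have least: "p \<le> r" if "P r" for r
    using that unfolding p_def period_length_def P_def by (rule Least_le)
  \<comment> \<open>A shift by a multiple of \<open>q\<close> jumps past the preperiod without
    changing the value, so the least eventual period also holds from index 0 on.\<close>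
  have p: "s (i + p) = s i" for i
  proof -
    have "m \<le> q * m"
      by (simp add: q_def)
    then have "s (i + q * m + p) = s (i + q * m)"
      by (intro m) (rule trans_le_add2)
    then show ?thesis
      using q[of "i + p" m] q[of i m] by (simp add: algebra_simps)
  qed
  have pm: "s (i + p * n) = s i" for i n
  proof (induction n)
    case (Suc n)
    then show ?case
      using p[of "i + p * n"] by (simp add: algebra_simps)
  qed simp
  \<comment> \<open>A repetition inside one window would propagate forward and yield a positive
    period below \<open>p\<close>.\<close>
  have "inj_on s {..<p}"
  proof (rule linorder_inj_onI)
    fix i j assume "i < j" "i \<in> {..<p}" "j \<in> {..<p}"
    show "s i \<noteq> s j"
    proof
      assume eq: "s i = s j"
      have "s (n + (j - i)) = s n" if "n \<ge> i" for n
        using shift[OF eq, of "n - i"] that \<open>i < j\<close> by (simp add: algebra_simps)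
      then have "P (j - i)"
        using \<open>i < j\<close> by (auto simp: P_def)
      from least[OF this] show False
        using \<open>i < j\<close> \<open>j \<in> {..<p}\<close> by simp
    qed
  qed auto
  moreover have "range s = s ` {..<p}"
  proof -
    have "s i \<in> s ` {..<p}" for i
      using pm[of "i mod p" "i div p"] \<open>p > 0\<close> by (intro image_eqI[of _ _ "i mod p"]) simp_all
    then show ?thesis
      by blast
  qed
  ultimately show ?thesis
    by (simp add: card_image flip: p_def)
qed

section \<open>Digit expansions modulo the ideal of both polynomials\<close>

text \<open>The class of \<open>g\<close> modulo \<open>f1\<close> is expanded with digits in
  \<open>N1\<close>. In the larger ideal each digit may be replaced by \<open>dt\<close>, and a
  constant digit sequence has a geometric sum as value.\<close>

lemma partial_sums_exhaust:
  fixes f1 f2 :: "'e::idom poly"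
  assumes "shared_digits_setting f1 f2 N1 N2 dt"
  shows "\<exists>i. g - dt * (\<Sum>j\<le>i. [:0, 1:] ^ j) \<in> poly_ideal {f1, f2}"
proof -
  let ?I = "poly_ideal {f1, f2}"
  have N1: "N1 \<subseteq> carrier (quot_ring {f1})"
    using assms by (simp add: shared_digits_setting_def irredundant_digit_system_def digit_system_def)
  have fep: "finite_expansion_property (quot_ring {f1}) (mult_X {f1}) N1"
    and "\<forall>d \<in> N1 \<union> N2. \<forall>g \<in> d. g - dt \<in> ?I"
    using assms by (simp_all add: shared_digits_setting_def)
  then have cong: "e - dt \<in> ?I" if "d \<in> N1" "e \<in> d" for d e
    using that by blast
  have "residue_class {f1} g \<in> carrier (quot_ring {f1})"
    by (simp add: carrier_quot_ring)
  with fep obtain ds where ds: "ds \<noteq> []" "set ds \<subseteq> N1"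
      "(\<Oplus>\<^bsub>quot_ring {f1}\<^esub> i \<in> {..<length ds}. (mult_X {f1} ^^ i) (ds ! i)) = residue_class {f1} g"
    unfolding finite_expansion_property_def expansion_of_def by blast
  have "\<exists>e. ds ! i = residue_class {f1} e" if "i < length ds" for i
  proof -
    have "ds ! i \<in> range (residue_class {f1})"
      using ds(2) N1 nth_mem[OF that] unfolding carrier_quot_ring by blast
    then show ?thesis
      by blast
  qed
  then obtain e where e: "\<And>i. i < length ds \<Longrightarrow> ds ! i = residue_class {f1} (e i)"
    by metis
  have "(\<Oplus>\<^bsub>quot_ring {f1}\<^esub> i \<in> {..<length ds}. (mult_X {f1} ^^ i) (ds ! i))
      = (\<Oplus>\<^bsub>quot_ring {f1}\<^esub> i \<in> {..<length ds}. residue_class {f1} ([:0, 1:] ^ i * e i))"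
  proof -
    interpret Q: cring "quot_ring {f1}"
      by (rule cring_quot_ring)
    show ?thesis
      by (intro Q.finsum_cong') (auto simp: e mult_X_funpow carrier_quot_ring)
  qed
  with ds(3) have "residue_class {f1} g = residue_class {f1} (\<Sum>i<length ds. [:0, 1:] ^ i * e i)"
    by (simp add: residue_class_sum)
  then have "g - (\<Sum>i<length ds. [:0, 1:] ^ i * e i) \<in> ?I"
    using poly_ideal_mono[of "{f1}" "{f1, f2}"] by (auto simp: residue_class_eq_iff)
  \<comment> \<open>This is the error made by replacing each digit representative \<open>e i\<close>
    by \<open>dt\<close>.\<close>
  moreover have "(\<Sum>i<length ds. [:0, 1:] ^ i * (e i - dt)) \<in> ?I"
  proof (intro poly_ideal_sum poly_ideal_mult)
    fix i assume "i \<in> {..<length ds}"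
    then have i: "i < length ds" by simp
    show "e i - dt \<in> ?I"
    proof (rule cong)
      show "ds ! i \<in> N1" using ds(2) i by auto
      show "e i \<in> ds ! i" by (simp add: e[OF i] mem_residue_class_iff poly_ideal_zero)
    qed
  qed
  ultimately have "(g - (\<Sum>i<length ds. [:0, 1:] ^ i * e i)) + (\<Sum>i<length ds. [:0, 1:] ^ i * (e i - dt)) \<in> ?I"
    by (rule poly_ideal_add)
  moreover have "(g - (\<Sum>i<length ds. [:0, 1:] ^ i * e i)) + (\<Sum>i<length ds. [:0, 1:] ^ i * (e i - dt))
      = g - dt * (\<Sum>i<length ds. [:0, 1:] ^ i)"
    by (simp add: algebra_simps sum_subtractf sum_distrib_left sum_distrib_right)
  \<comment> \<open>Expansions are nonempty, so there is a last index, and the sum has the shape of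
    a member of \<open>s_seq\<close>.\<close>
  moreover have "{..<length ds} = {..length ds - 1}"
    using ds(1) by (cases ds) auto
  ultimately show ?thesis
    by metis
qed

lemma s_seq_surj:
  assumes "shared_digits_setting f1 f2 N1 N2 dt"
  shows "range (s_seq {f1, f2} (residue_class {f1, f2} dt)) = carrier (quot_ring {f1, f2})"
proof -
  have "\<exists>i. residue_class {f1, f2} g = s_seq {f1, f2} (residue_class {f1, f2} dt) i" for g
    using partial_sums_exhaust[OF assms, of g] by (simp add: s_seq_residue_class residue_class_eq_iff)
  then show ?thesis
    unfolding carrier_quot_ring by (auto simp: s_seq_residue_class) (metis rangeI)
qed

lemma shared_digit_unit:
  assumes "shared_digits_setting f1 f2 N1 N2 dt"
  shows "residue_class {f1, f2} dt \<in> Units (quot_ring {f1, f2})"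
proof -
  interpret Q: cring "quot_ring {f1, f2}"
    by (rule cring_quot_ring)
  obtain i where "1 - dt * (\<Sum>j\<le>i. [:0, 1:] ^ j) \<in> poly_ideal {f1, f2}"
    using partial_sums_exhaust[OF assms] by blast
  then have "residue_class {f1, f2} dt \<otimes>\<^bsub>quot_ring {f1, f2}\<^esub> residue_class {f1, f2} (\<Sum>j\<le>i. [:0, 1:] ^ j)
      = \<one>\<^bsub>quot_ring {f1, f2}\<^esub>"
    unfolding residue_class_mult residue_class_one by (metis residue_class_eq_iff)
  then show ?thesis
    unfolding Units_def by (simp add: carrier_quot_ring) (metis Q.m_comm carrier_quot_ring rangeI)
qed

lemma S_period_eq_card:
  assumes "shared_digits_setting f1 f2 N1 N2 dt"
  shows "S_period {f1, f2} (residue_class {f1, f2} dt) = card (carrier (quot_ring {f1, f2}))"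
proof -
  let ?r = "residue_class {f1, f2}"
  let ?s = "s_seq {f1, f2} (?r dt)"
  obtain k where "?s k = ?r 0"
    using s_seq_surj[OF assms] carrier_quot_ring[of "{f1, f2}"] by (metis rangeE rangeI)
  \<comment> \<open>Splitting off the summand j = 0 turns the sequence into the orbit of an affine
    map. This map sends 0, which is attained, to the class of \<open>dt\<close>, the first
    member.\<close>
  moreover have "?s (Suc i) = ?r dt \<oplus>\<^bsub>quot_ring {f1, f2}\<^esub> mult_X {f1, f2} (?s i)" for i
    unfolding s_seq_residue_class mult_X_def residue_class_mult residue_class_add
    by (subst sum.atMost_Suc_shift) (simp add: algebra_simps sum_distrib_left)
  moreover have "?r dt \<oplus>\<^bsub>quot_ring {f1, f2}\<^esub> mult_X {f1, f2} (?r 0) = ?s 0"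
    by (simp add: s_seq_residue_class mult_X_def residue_class_mult residue_class_add)
  ultimately have "period_length ?s = card (range ?s)"
    by (intro period_length_iterate)
  then show ?thesis
    by (simp add: S_period_def s_seq_surj[OF assms])
qed

section \<open>The case of a linear polynomial\<close>

text \<open>Evaluation at \<open>a\<close> kills x - a and sends \<open>f2\<close> to a multiple of
  \<open>m\<close>, so exhausting all classes modulo the ideal descends to the integers modulo
  \<open>m\<close>.\<close>

lemma poly_eval_surj_mod:
  fixes f2 :: "int poly"
  assumes "shared_digits_setting [:- a, 1:] f2 N1 N2 dt" and "m dvd poly f2 a"
  shows "\<exists>i. [poly dt a * (\<Sum>j\<le>i. a ^ j) = c] (mod m)"
proof -
  obtain i u v where "[:c:] - dt * (\<Sum>j\<le>i. [:0, 1:] ^ j) = u * [:- a, 1:] + v * f2"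
    using partial_sums_exhaust[OF assms(1), of "[:c:]"] unfolding poly_ideal_pair by auto
  from arg_cong[OF this, of "\<lambda>p. poly p a"]
  have "c - poly dt a * (\<Sum>j\<le>i. a ^ j) = poly v a * poly f2 a"
    by (simp add: poly_sum)
  then have "m dvd c - poly dt a * (\<Sum>j\<le>i. a ^ j)"
    using assms(2) by simp
  then show ?thesis
    by (metis cong_iff_dvd_diff cong_sym)
qed

text \<open>Write d for the value of \<open>dt\<close> at \<open>a\<close>. If \<open>a\<close> is
  not 1 modulo \<open>p\<close>, the map s -> d + a s has the fixed point d / (1 - a), which the
  orbit must visit. It cannot: attaining 1 makes d a unit, attaining 0 makes \<open>a\<close> a
  unit, and then the orbit never meets the fixed point.\<close>

lemma cong_1_mod_prime:
  fixes f2 :: "int poly"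
  assumes "shared_digits_setting [:- a, 1:] f2 N1 N2 dt" and "prime p" and "p dvd poly f2 a"
  shows "[a = 1] (mod p)"
proof (rule ccontr)
  assume na: "\<not> [a = 1] (mod p)"
  let ?d = "poly dt a"
  have p: "\<not> p dvd 1"
    using assms(2) not_prime_unit by blast
  obtain i where "[?d * (\<Sum>j\<le>i. a ^ j) = 0] (mod p)"
    using poly_eval_surj_mod[OF assms(1,3), of 0] by blast
  then have i: "p dvd ?d * (\<Sum>j\<le>i. a ^ j)"
    by (simp add: cong_0_iff)
  obtain j where j: "[?d * (\<Sum>l\<le>j. a ^ l) = 1] (mod p)"
    using poly_eval_surj_mod[OF assms(1,3)] by blast
  then have "\<not> p dvd ?d"
    using p by (metis cong_dvd_iff dvd_mult2)
  with i assms(2) have *: "p dvd (\<Sum>j\<le>i. a ^ j)"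
    by (simp add: prime_dvd_mult_iff)
  \<comment> \<open>Were \<open>a\<close> divisible by \<open>p\<close>, every geometric sum would
    be 1 modulo \<open>p\<close>.\<close>
  have pa: "\<not> p dvd a"
  proof
    assume "p dvd a"
    then have "p dvd (\<Sum>j\<in>{1..i}. a ^ j)"
      by (intro dvd_sum) (auto intro: dvd_trans dvd_power)
    moreover have "(\<Sum>j\<le>i. a ^ j) = 1 + (\<Sum>j\<in>{1..i}. a ^ j)"
      by (simp add: atMost_atLeast0 sum.atLeast_Suc_atMost)
    ultimately show False
      using * p by (metis dvd_add_left_iff)
  qed
  text \<open>The value \<open>d / (1 - a)\<close> would force a power of \<open>a\<close> to vanish modulo \<open>p\<close>.\<close>
  have "coprime (1 - a) p"
    using na assms(2) by (metis cong_iff_dvd_diff cong_sym coprime_commute prime_imp_coprime)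
  then obtain b where b: "[(1 - a) * b = 1] (mod p)"
    using cong_solve_coprime_int by blast
  obtain k where k: "[?d * (\<Sum>l\<le>k. a ^ l) = ?d * b] (mod p)"
    using poly_eval_surj_mod[OF assms(1,3)] by blast
  have "[(1 - a) * (?d * (\<Sum>l\<le>k. a ^ l)) = (1 - a) * (?d * b)] (mod p)"
    using k by (rule cong_scalar_left)
  also have "(1 - a) * (?d * b) = ?d * ((1 - a) * b)"
    by simp
  also have "[\<dots> = ?d * 1] (mod p)"
    using b by (rule cong_scalar_left)
  also have "(1 - a) * (?d * (\<Sum>l\<le>k. a ^ l)) = ?d * (1 - a ^ Suc k)"
    using one_diff_power_eq[of a "Suc k"] by (simp add: lessThan_Suc_atMost)
  finally have "p dvd ?d * (1 - a ^ Suc k) - ?d * 1"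
    by (simp add: cong_iff_dvd_diff)
  then have "p dvd ?d * a ^ Suc k"
    by (simp add: algebra_simps)
  with assms(2) pa \<open>\<not> p dvd ?d\<close> show False
    by (metis prime_dvd_mult_iff prime_dvd_power)
qed

text \<open>The prime 2 makes \<open>a\<close> odd, which leaves -1 modulo 4 as the only other case.
  There the geometric sums alternate between 1 and 0, so at most two of the four residues are
  attained.\<close>

lemma cong_1_mod_4:
  fixes f2 :: "int poly"
  assumes "shared_digits_setting [:- a, 1:] f2 N1 N2 dt" and "4 dvd poly f2 a"
  shows "[a = 1] (mod 4)"
proof (rule ccontr)
  assume na: "\<not> [a = 1] (mod 4)"
  let ?d = "poly dt a"
  have "(2::int) dvd poly f2 a"
    using assms(2) by (rule dvd_trans[rotated]) simp
  then have "[a = 1] (mod 2)"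
    by (intro cong_1_mod_prime[OF assms(1)]) auto
  with na have a: "a mod 4 = 3"
    by (simp add: cong_def) presburger
  have sums: "(\<Sum>j\<le>i. a ^ j) mod 4 \<in> {0, 1}" for i
  proof -
    have "[(\<Sum>j\<le>i. a ^ j) = (\<Sum>j\<le>i. (-1) ^ j)] (mod 4)"
      using a by (intro cong_sum cong_pow) (simp add: cong_def)
    moreover have "(\<Sum>j\<le>i. (-1) ^ j) = (if even i then 1 else 0 :: int)"
      by (induction i) auto
    ultimately show ?thesis
      by (auto simp: cong_def split: if_splits)
  qed
  have "(?d * (\<Sum>j\<le>i. a ^ j)) mod 4 \<in> {0, ?d mod 4}" for i
    using sums[of i] mod_mult_right_eq[of ?d "\<Sum>j\<le>i. a ^ j" 4] by auto
  then have "c mod 4 \<in> {0, ?d mod 4}" for c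
    using poly_eval_surj_mod[OF assms, of c] unfolding cong_def by metis
  from this[of 1] this[of 2] this[of 3] show False
    by auto
qed


section \<open>The index of an integer lattice\<close>

text \<open>\<open>L\<close> models a sublattice of Z^N in coefficient coordinates. Full rank is
  expressed by a nonzero multiple of every monomial, which is what finiteness of the quotient
  supplies directly.\<close>

locale full_poly_lattice =
  fixes L :: "int poly set" and N :: nat
  assumes lattice_zero: "0 \<in> L"
    and lattice_add: "\<And>g h. g \<in> L \<Longrightarrow> h \<in> L \<Longrightarrow> g + h \<in> L"
    and lattice_smult: "\<And>c g. g \<in> L \<Longrightarrow> smult c g \<in> L"
    and lattice_coeff: "\<And>g k. g \<in> L \<Longrightarrow> k \<ge> N \<Longrightarrow> coeff g k = 0"
    and lattice_full: "\<And>k. k < N \<Longrightarrow> \<exists>c. c \<noteq> 0 \<and> monom c k \<in> L"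
begin

lemma lattice_diff: "g \<in> L \<Longrightarrow> h \<in> L \<Longrightarrow> g - h \<in> L"
  using lattice_add[OF _ lattice_smult[of h "-1"], of g] by simp

text \<open>Such an element serves as one row of a Hermite normal form without normalised entries
  off the diagonal: its top coefficient generates the ideal of all coefficients at x^k of lattice
  elements without higher terms.\<close>

definition hermite_elem :: "nat \<Rightarrow> int poly \<Rightarrow> bool" where
  "hermite_elem k h \<longleftrightarrow> h \<in> L \<and> (\<forall>j>k. coeff h j = 0) \<and> coeff h k > 0 \<and>
     (\<forall>g\<in>L. (\<forall>j>k. coeff g j = 0) \<longrightarrow> coeff h k dvd coeff g k)"

text \<open>The least positive coefficient that occurs at x^k works, because division with remainder
  would otherwise produce a smaller one.\<close>

lemma hermite_elem_exists:
  assumes "k < N"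
  shows "\<exists>h. hermite_elem k h"
proof -
  define P where "P n \<longleftrightarrow> n > 0 \<and> (\<exists>g\<in>L. (\<forall>j>k. coeff g j = 0) \<and> coeff g k = int n)" for n
  obtain c where c: "c \<noteq> 0" "monom c k \<in> L"
    using lattice_full[OF assms] by blast
  then have "smult (sgn c) (monom c k) \<in> L"
    using lattice_smult by blast
  then have "monom \<bar>c\<bar> k \<in> L"
    by (simp add: smult_monom sgn_mult_self_eq abs_sgn mult.commute)
  then have "P (nat \<bar>c\<bar>)"
    using c(1) unfolding P_def by (auto intro!: bexI[of _ "monom \<bar>c\<bar> k"])
  then have least: "P (LEAST n. P n)"
    by (rule LeastI)
  define a where "a = (LEAST n. P n)"
  obtain h where h: "h \<in> L" "\<And>j. j > k \<Longrightarrow> coeff h j = 0" "coeff h k = int a" "a > 0"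
    using least unfolding a_def P_def by blast
  have "int a dvd coeff g k" if g: "g \<in> L" "\<forall>j>k. coeff g j = 0" for g
  proof (rule ccontr)
    assume "\<not> int a dvd coeff g k"
    then have pos: "coeff g k mod int a > 0"
      using h(4) by (metis dvd_eq_mod_eq_0 of_nat_0_less_iff pos_mod_sign order_le_less)
    let ?r = "g - smult (coeff g k div int a) h"
    have "?r \<in> L"
      using g(1) h(1) by (intro lattice_diff lattice_smult)
    moreover have "coeff ?r k = int (nat (coeff g k mod int a))"
      using pos by (simp add: h(3) minus_div_mult_eq_mod)
    ultimately have "P (nat (coeff g k mod int a))"
      using pos g(2) h(2) unfolding P_def by (intro conjI bexI[of _ ?r]) auto
    then have "a \<le> nat (coeff g k mod int a)"
      unfolding a_def by (rule Least_le)
    moreover have "coeff g k mod int a < int a"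
      using h(4) by simp
    ultimately show False
      using pos by linarith
  qed
  then show ?thesis
    using h unfolding hermite_elem_def by auto
qed

section \<open>Division by a triangular lattice basis\<close>

context
  fixes h :: "nat \<Rightarrow> int poly"
  assumes h: "\<And>k. k < N \<Longrightarrow> hermite_elem k (h k)"
begin

lemma hermite_span:
  assumes "g \<in> L"
  shows "\<exists>c. g = (\<Sum>k<N. smult (c k) (h k))"
proof -
  \<comment> \<open>Induction on the degree bound: a multiple of \<open>h n\<close> removes the
    coefficient at x^n and creates no higher terms.\<close>
  have "\<exists>c. g = (\<Sum>k<n. smult (c k) (h k))"
    if "g \<in> L" "\<forall>k\<ge>n. coeff g k = 0" "n \<le> N" for n
    using that
  proof (induction n arbitrary: g)
    case 0
    then show ?case
      by (auto intro: poly_eqI)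
  next
    case (Suc n)
    then have hn: "hermite_elem n (h n)"
      using h by simp
    moreover have "\<forall>j>n. coeff g j = 0"
      using Suc.prems by auto
    ultimately have "coeff (h n) n dvd coeff g n"
      using Suc.prems by (simp add: hermite_elem_def)
    then obtain t where t: "coeff g n = coeff (h n) n * t" ..
    let ?g = "g - smult t (h n)"
    have "coeff ?g k = 0" if "k \<ge> n" for k
      using that hn t Suc.prems by (cases "k = n") (auto simp: hermite_elem_def)
    moreover have "?g \<in> L"
      using Suc.prems hn by (intro lattice_diff lattice_smult) (auto simp: hermite_elem_def)
    ultimately obtain c where c: "?g = (\<Sum>k<n. smult (c k) (h k))"
      using Suc.IH[of ?g] Suc.prems(3) by (meson Suc_leD)
    have "g = (\<Sum>k<Suc n. smult ((c(n := t)) k) (h k))"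
      using c by (simp add: algebra_simps)
    then show ?case
      by blast
  qed
  then show ?thesis
    using assms lattice_coeff by blast
qed

lemma hermite_reduce:
  assumes "\<forall>k\<ge>N. coeff g k = 0"
  shows "\<exists>r. g - r \<in> L \<and> (\<forall>k\<ge>N. coeff r k = 0) \<and> (\<forall>k<N. coeff r k \<in> {0..<coeff (h k) k})"
proof -
  \<comment> \<open>Here \<open>n\<close> counts the coefficients already reduced, starting from the
    top. The order matters, since subtracting a multiple of \<open>h m\<close> disturbs only the
    coefficients at \<open>m\<close> and below.\<close>
  have "\<exists>r. g - r \<in> L \<and> (\<forall>k\<ge>N. coeff r k = 0) \<and>
      (\<forall>k<N. k \<ge> N - n \<longrightarrow> coeff r k \<in> {0..<coeff (h k) k})" if "n \<le> N" for n
    using that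
  proof (induction n)
    case 0
    then show ?case
      using assms by (intro exI[of _ g]) (auto simp: lattice_zero)
  next
    case (Suc n)
    then obtain r where r: "g - r \<in> L" "\<forall>k\<ge>N. coeff r k = 0"
        "\<forall>k<N. k \<ge> N - n \<longrightarrow> coeff r k \<in> {0..<coeff (h k) k}"
      by auto
    define m where "m = N - Suc n"
    have m: "m < N" "N - n = Suc m"
      using Suc.prems by (auto simp: m_def)
    note hm = h[OF m(1)]
    let ?t = "coeff r m div coeff (h m) m"
    let ?r = "r - smult ?t (h m)"
    have "g - ?r = (g - r) + smult ?t (h m)"
      by simp
    also have "\<dots> \<in> L"
      using r(1) hm unfolding hermite_elem_def by (intro lattice_add lattice_smult) auto
    finally have "g - ?r \<in> L" .
    moreover have "\<forall>k\<ge>N. coeff ?r k = 0"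
      using r(2) hm m by (auto simp: hermite_elem_def)
    moreover have "coeff ?r k \<in> {0..<coeff (h k) k}" if "k < N" "k \<ge> m" for k
    proof (cases "k = m")
      case True
      then show ?thesis
        using hm by (simp add: hermite_elem_def minus_div_mult_eq_mod)
    next
      case False
      then show ?thesis
        using that r(3) hm m by (auto simp: hermite_elem_def)
    qed
    ultimately show ?case
      unfolding m_def by blast
  qed
  from this[of N] show ?thesis
    by auto
qed

text \<open>The leading coefficient of a nonzero difference would be a multiple of the diagonal
  entry, yet smaller in absolute value.\<close>

lemma hermite_rep_unique:
  assumes "r - r' \<in> L"
    and "\<forall>k<N. coeff r k \<in> {0..<coeff (h k) k}" "\<forall>k<N. coeff r' k \<in> {0..<coeff (h k) k}"
  shows "r = r'"
proof (rule ccontr)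
  let ?g = "r - r'"
  define k where "k = degree ?g"
  assume "r \<noteq> r'"
  then have nz: "coeff ?g k \<noteq> 0"
    unfolding k_def by (metis eq_iff_diff_eq_0 leading_coeff_0_iff)
  then have k: "k < N"
    using lattice_coeff[OF assms(1), of k] by (meson not_less)
  have "coeff (h k) k dvd coeff ?g k"
    using h[OF k] assms(1) by (auto simp: hermite_elem_def k_def coeff_eq_0 simp del: coeff_diff)
  then have "\<bar>coeff (h k) k\<bar> \<le> \<bar>coeff ?g k\<bar>"
    using nz by (intro dvd_imp_le_int)
  moreover have "coeff r k \<in> {0..<coeff (h k) k}" "coeff r' k \<in> {0..<coeff (h k) k}"
    using assms k by blast+
  ultimately show False
    by auto
qed

section \<open>Counting residue classes by a box of coefficients\<close>

definition box_poly :: "(nat \<Rightarrow> int) \<Rightarrow> int poly" where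
  "box_poly f = (\<Sum>k<N. monom (f k) k)"

lemma coeff_box_poly: "coeff (box_poly f) k = (if k < N then f k else 0)"
  by (simp add: box_poly_def coeff_sum)

text \<open>The map \<pi> abstracts the passage to residue classes; all that enters is that its
  fibres on polynomials of degree below \<open>N\<close> are cosets of \<open>L\<close>.\<close>

lemma bij_betw_box:
  fixes \<pi> :: "int poly \<Rightarrow> 'q"
  assumes \<pi>: "\<And>g h. \<forall>k\<ge>N. coeff g k = 0 \<Longrightarrow> \<forall>k\<ge>N. coeff h k = 0 \<Longrightarrow>
      \<pi> g = \<pi> h \<longleftrightarrow> g - h \<in> L"
  shows "bij_betw (\<lambda>f. \<pi> (box_poly f)) (PiE {..<N} (\<lambda>k. {0..<coeff (h k) k}))
    (\<pi> ` {g. \<forall>k\<ge>N. coeff g k = 0})"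
  (is "bij_betw ?F ?B (\<pi> ` ?P)")
proof (rule bij_betw_imageI)
  have P: "box_poly f \<in> ?P" for f
    by (simp add: coeff_box_poly)
  show "inj_on ?F ?B"
  proof (rule inj_onI)
    fix f f' assume f: "f \<in> ?B" "f' \<in> ?B" and "?F f = ?F f'"
    then have "box_poly f - box_poly f' \<in> L"
      using \<pi>[of "box_poly f" "box_poly f'"] P by blast
    then have eq: "box_poly f = box_poly f'"
      using f by (intro hermite_rep_unique) (auto simp: coeff_box_poly PiE_iff)
    have "f k = f' k" if "k < N" for k
      using arg_cong[OF eq, of "\<lambda>p. coeff p k"] that by (simp add: coeff_box_poly)
    then show "f = f'"
      using f by (intro PiE_ext[of f]) auto
  qed
  have "\<pi> g \<in> ?F ` ?B" if g: "g \<in> ?P" for g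
  proof -
    obtain r where r: "g - r \<in> L" "\<forall>k\<ge>N. coeff r k = 0" "\<forall>k<N. coeff r k \<in> {0..<coeff (h k) k}"
      using hermite_reduce g by blast
    \<comment> \<open>The restriction makes the coefficient function extensional, as membership in
      \<open>PiE\<close> demands.\<close>
    define f where "f = restrict (coeff r) {..<N}"
    have "box_poly f = r"
      using r(2) by (auto simp: poly_eq_iff coeff_box_poly f_def)
    moreover have "f \<in> ?B"
      using r(3) by (auto simp: f_def PiE_iff)
    moreover have "\<pi> g = \<pi> r"
      using \<pi>[of g r] g r(1,2) by simp
    ultimately show ?thesis
      by (intro image_eqI[of _ _ f]) simp_all
  qed
  then show "?F ` ?B = \<pi> ` ?P"
    using P by blast
qed

lemma card_quotient_hermite:
  fixes \<pi> :: "int poly \<Rightarrow> 'q"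
  assumes "\<And>g h. \<forall>k\<ge>N. coeff g k = 0 \<Longrightarrow> \<forall>k\<ge>N. coeff h k = 0 \<Longrightarrow>
      \<pi> g = \<pi> h \<longleftrightarrow> g - h \<in> L"
  shows "int (card (\<pi> ` {g. \<forall>k\<ge>N. coeff g k = 0})) = (\<Prod>k<N. coeff (h k) k)"
proof -
  have "card (\<pi> ` {g. \<forall>k\<ge>N. coeff g k = 0}) = card (PiE {..<N} (\<lambda>k. {0..<coeff (h k) k}))"
    using bij_betw_box[of \<pi>] assms by (metis (no_types, lifting) bij_betw_same_card)
  also have "\<dots> = (\<Prod>k<N. nat (coeff (h k) k))"
    by (simp add: card_PiE)
  also have "int \<dots> = (\<Prod>k<N. coeff (h k) k)"
    unfolding of_nat_prod using h by (intro prod.cong) (auto simp: hermite_elem_def order_less_imp_le)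
  finally show ?thesis .
qed

end

text \<open>Columns run from high to low powers, as in the Sylvester matrix.\<close>

definition coeff_mat :: "(nat \<Rightarrow> int poly) \<Rightarrow> int mat" where
  "coeff_mat p = mat N N (\<lambda>(i, j). coeff (p i) (N - 1 - j))"

text \<open>The coefficients of the combinations form an integer matrix that carries one coefficient
  matrix to the other, and determinants are multiplicative.\<close>

lemma det_coeff_mat_dvd:
  assumes "\<And>i. i < N \<Longrightarrow> \<exists>c. p i = (\<Sum>j<N. smult (c j) (q j))"
  shows "det (coeff_mat q) dvd det (coeff_mat p)"
proof -
  obtain c where c: "\<And>i. i < N \<Longrightarrow> p i = (\<Sum>j<N. smult (c i j) (q j))"
    using assms by metis
  have "coeff_mat p = mat N N (\<lambda>(i, j). c i j) * coeff_mat q"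
    by (rule eq_matI)
       (auto simp: coeff_mat_def scalar_prod_def c coeff_sum atLeast0LessThan intro!: sum.cong)
  then have "det (coeff_mat p) = det (mat N N (\<lambda>(i, j). c i j)) * det (coeff_mat q)"
    by (simp add: det_mult[of _ N] coeff_mat_def)
  then show ?thesis
    by simp
qed

lemma card_quotient_eq_det:
  fixes \<pi> :: "int poly \<Rightarrow> 'q"
  assumes \<pi>: "\<And>g h. \<forall>k\<ge>N. coeff g k = 0 \<Longrightarrow> \<forall>k\<ge>N. coeff h k = 0 \<Longrightarrow>
      \<pi> g = \<pi> h \<longleftrightarrow> g - h \<in> L"
    and q: "\<And>i. i < N \<Longrightarrow> q i \<in> L"
    and span: "\<And>g. g \<in> L \<Longrightarrow> \<exists>c. g = (\<Sum>j<N. smult (c j) (q j))"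
  shows "int (card (\<pi> ` {g. \<forall>k\<ge>N. coeff g k = 0})) = \<bar>det (coeff_mat q)\<bar>"
proof -
  obtain h where h: "\<And>k. k < N \<Longrightarrow> hermite_elem k (h k)"
    using hermite_elem_exists by metis
  \<comment> \<open>The order is reversed because columns descend in powers; this makes the
    coefficient matrix upper triangular.\<close>
  define h' where "h' i = h (N - 1 - i)" for i
  have h': "h' i \<in> L" if "i < N" for i
    using that h[of "N - 1 - i"] by (simp add: h'_def hermite_elem_def)
  have "\<exists>c. g = (\<Sum>j<N. smult (c j) (h' j))" if g: "g \<in> L" for g
  proof -
    obtain c where "g = (\<Sum>k<N. smult (c k) (h k))"
      using hermite_span[OF h g] by blast
    also have "\<dots> = (\<Sum>j<N. smult (c (N - Suc j)) (h (N - Suc j)))"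
      by (rule sum.nat_diff_reindex[symmetric])
    finally show ?thesis
      unfolding h'_def by (intro exI[of _ "\<lambda>j. c (N - Suc j)"]) simp
  qed
  then have "det (coeff_mat h') dvd det (coeff_mat q)"
    using q by (intro det_coeff_mat_dvd) blast
  moreover have "det (coeff_mat q) dvd det (coeff_mat h')"
    using h' span by (intro det_coeff_mat_dvd) blast
  ultimately have "\<bar>det (coeff_mat q)\<bar> = \<bar>det (coeff_mat h')\<bar>"
    by (rule zdvd_antisym_abs[rotated])
  also have "det (coeff_mat h') = (\<Prod>k<N. coeff (h k) k)"
  proof -
    have "upper_triangular (coeff_mat h')"
    proof (rule upper_triangularI)
      fix i j assume "j < i" "i < dim_row (coeff_mat h')"
      then show "coeff_mat h' $$ (i, j) = 0"
        using h[of "N - 1 - i"] by (auto simp: coeff_mat_def h'_def hermite_elem_def)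
    qed
    then have "det (coeff_mat h') = prod_list (diag_mat (coeff_mat h'))"
      by (rule det_upper_triangular[of _ N]) (simp add: coeff_mat_def)
    also have "\<dots> = (\<Prod>i<N. coeff (h (N - Suc i)) (N - Suc i))"
      unfolding prod_list_diag_prod
      by (auto simp: coeff_mat_def h'_def atLeast0LessThan intro!: prod.cong)
    also have "\<dots> = (\<Prod>k<N. coeff (h k) k)"
      by (rule prod.nat_diff_reindex)
    finally show ?thesis .
  qed
  also have "\<bar>\<Prod>k<N. coeff (h k) k\<bar> = int (card (\<pi> ` {g. \<forall>k\<ge>N. coeff g k = 0}))"
    using card_quotient_hermite[of h \<pi>, OF h \<pi>] by presburger
  finally show ?thesis
    by simp
qed

end


section \<open>The order of the residue class ring as a resultant\<close>

text \<open>The bound \<open>s\<close> on the degree of \<open>u\<close> need not be attained, so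
  the top coefficient may vanish on both sides.\<close>

lemma coeff_mult_bound:
  fixes u f :: "'a::comm_semiring_1 poly"
  assumes "\<And>k. k > s \<Longrightarrow> coeff u k = 0"
  shows "coeff (u * f) (s + degree f) = coeff u s * lead_coeff f"
    and "k > s + degree f \<Longrightarrow> coeff (u * f) k = 0"
proof -
  have le: "degree u \<le> s"
    using assms by (intro degree_le) simp
  show "k > s + degree f \<Longrightarrow> coeff (u * f) k = 0"
    using degree_mult_le[of u f] le by (intro coeff_eq_0) linarith
  show "coeff (u * f) (s + degree f) = coeff u s * lead_coeff f"
  proof (cases "degree u = s")
    case True
    then show ?thesis
      using coeff_mult_degree_sum[of u f] by simp
  next
    case False
    then have "degree u < s"
      using le by simp
    then show ?thesis
      using degree_mult_le[of u f] by (simp add: coeff_eq_0)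
  qed
qed

context
  fixes f1 f2 :: "int poly"
  assumes lead: "coprime (lead_coeff f1) (lead_coeff f2)"
begin

text \<open>When both cofactors exceed their bounds, the top terms must cancel. Coprime leading
  coefficients make this cancellation a multiple of the trivial relation f2 f1 - f1 f2 = 0, which is
  subtracted.\<close>

lemma ideal_bounded_combination:
  assumes "g \<in> poly_ideal {f1, f2}" and g: "\<forall>k \<ge> degree f1 + degree f2. coeff g k = 0"
  shows "\<exists>u v. g = u * f1 + v * f2 \<and> (\<forall>k \<ge> degree f2. coeff u k = 0) \<and>
    (\<forall>k \<ge> degree f1. coeff v k = 0)"
proof -
  let ?m = "degree f1" and ?n = "degree f2"
  obtain \<alpha> \<beta> where bezout: "\<alpha> * lead_coeff f1 + \<beta> * lead_coeff f2 = 1"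
    using lead by (metis bezout_int coprime_iff_gcd_eq_1)
  obtain u0 v0 where uv0: "g = u0 * f1 + v0 * f2"
    using assms(1) unfolding poly_ideal_pair by blast
  have "\<exists>u v. g = u * f1 + v * f2 \<and> (\<forall>k \<ge> ?n. coeff u k = 0) \<and> (\<forall>k \<ge> ?m. coeff v k = 0)"
    if "g = u * f1 + v * f2" "\<forall>k \<ge> ?n + K. coeff u k = 0" "\<forall>k \<ge> ?m + K. coeff v k = 0" for u v K
    using that
  proof (induction K arbitrary: u v)
    case 0
    then show ?case
      by (intro exI[of _ u] exI[of _ v]) simp
  next
    case (Suc K)
    let ?a = "coeff u (?n + K)" and ?b = "coeff v (?m + K)"
    have "coeff g (?n + K + ?m) = 0"
      using g by simp
    moreover have "coeff (u * f1) (?n + K + ?m) = ?a * lead_coeff f1"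
      using Suc.prems(2) by (intro coeff_mult_bound) simp
    moreover have "coeff (v * f2) (?m + K + ?n) = ?b * lead_coeff f2"
      using Suc.prems(3) by (intro coeff_mult_bound) simp
    ultimately have cancel: "?a * lead_coeff f1 + ?b * lead_coeff f2 = 0"
      using Suc.prems(1) by (simp add: algebra_simps)
    \<comment> \<open>Solving t l2 = a and t l1 = -b for the leading coefficients l1, l2 and top
      coefficients a, b; the Bezout identity gives this value.\<close>
    define t where "t = \<beta> * ?a - \<alpha> * ?b"
    have "t * lead_coeff f2 - ?a
        = ?a * (\<alpha> * lead_coeff f1 + \<beta> * lead_coeff f2 - 1)
          - \<alpha> * (?a * lead_coeff f1 + ?b * lead_coeff f2)"
      by (simp add: t_def algebra_simps)
    then have ta: "t * lead_coeff f2 = ?a"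
      using bezout cancel by simp
    have "t * lead_coeff f1 + ?b
        = \<beta> * (?a * lead_coeff f1 + ?b * lead_coeff f2)
          - ?b * (\<alpha> * lead_coeff f1 + \<beta> * lead_coeff f2 - 1)"
      by (simp add: t_def algebra_simps)
    then have tb: "t * lead_coeff f1 = - ?b"
      using bezout cancel by simp
    have mono: "coeff (monom t K) k = 0" if "k > K" for k
      using that by simp
    show ?case
    proof (rule Suc.IH)
      show "g = (u - monom t K * f2) * f1 + (v + monom t K * f1) * f2"
        using Suc.prems(1) by (simp add: algebra_simps)
      show "\<forall>k \<ge> ?n + K. coeff (u - monom t K * f2) k = 0"
      proof (intro allI impI)
        fix k assume "k \<ge> ?n + K"
        then consider "k = K + ?n" | "k > K + ?n"
          by linarith
        then show "coeff (u - monom t K * f2) k = 0"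
        proof cases
          case 1
          then show ?thesis
            using coeff_mult_bound(1)[of K "monom t K" f2] mono ta by (simp add: add.commute)
        next
          case 2
          then show ?thesis
            using coeff_mult_bound(2)[of K "monom t K" f2 k] mono Suc.prems(2) by simp
        qed
      qed
      show "\<forall>k \<ge> ?m + K. coeff (v + monom t K * f1) k = 0"
      proof (intro allI impI)
        fix k assume "k \<ge> ?m + K"
        then consider "k = K + ?m" | "k > K + ?m"
          by linarith
        then show "coeff (v + monom t K * f1) k = 0"
        proof cases
          case 1
          then show ?thesis
            using coeff_mult_bound(1)[of K "monom t K" f1] mono tb by (simp add: add.commute)
        next
          case 2
          then show ?thesis
            using coeff_mult_bound(2)[of K "monom t K" f1 k] mono Suc.prems(3) by simp
        qed
      qed
    qed
  qed
  \<comment> \<open>This excess is large enough for both cofactors at once.\<close>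
  from this[OF uv0, of "Suc (degree u0 + degree v0)"] show ?thesis
    by (simp add: coeff_eq_0)
qed

lemma reduce_degree:
  "\<exists>r. g - r \<in> poly_ideal {f1, f2} \<and> (\<forall>k \<ge> degree f1 + degree f2. coeff r k = 0)"
proof -
  let ?m = "degree f1" and ?n = "degree f2"
  obtain \<alpha> \<beta> where bezout: "\<alpha> * lead_coeff f1 + \<beta> * lead_coeff f2 = 1"
    using lead by (metis bezout_int coprime_iff_gcd_eq_1)
  have "\<exists>r. g - r \<in> poly_ideal {f1, f2} \<and> (\<forall>k \<ge> ?m + ?n. coeff r k = 0)"
    if "\<forall>k \<ge> ?m + ?n + K. coeff g k = 0" for g K
    using that
  proof (induction K arbitrary: g)
    case 0
    then show ?case
      by (intro exI[of _ g]) (simp add: poly_ideal_zero)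
  next
    case (Suc K)
    define c where "c = coeff g (?m + ?n + K)"
    \<comment> \<open>Both products reach degree m + n + K, and by Bezout their top coefficients add
      up to \<open>c\<close>. So \<open>w\<close> acts like a multiple of a monic
      polynomial.\<close>
    define w where "w = monom (c * \<alpha>) (?n + K) * f1 + monom (c * \<beta>) (?m + K) * f2"
    have w: "w \<in> poly_ideal {f1, f2}"
      unfolding w_def poly_ideal_pair by blast
    have "coeff (g - w) k = 0" if "k \<ge> ?m + ?n + K" for k
    proof (cases "k = ?m + ?n + K")
      case True
      have "coeff (monom (c * \<alpha>) (?n + K) * f1) (?n + K + ?m) = c * \<alpha> * lead_coeff f1"
        by (subst coeff_mult_bound) auto
      moreover have "coeff (monom (c * \<beta>) (?m + K) * f2) (?m + K + ?n) = c * \<beta> * lead_coeff f2"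
        by (subst coeff_mult_bound) auto
      moreover have "c * \<alpha> * lead_coeff f1 + c * \<beta> * lead_coeff f2 = c"
        using arg_cong[OF bezout, of "\<lambda>x. c * x"] by (simp add: algebra_simps)
      ultimately show ?thesis
        by (simp add: w_def True c_def ac_simps)
    next
      case False
      then have k: "k > ?m + ?n + K"
        using that by simp
      then have "coeff (monom (c * \<alpha>) (?n + K) * f1) k = 0" "coeff (monom (c * \<beta>) (?m + K) * f2) k = 0"
        by (intro coeff_mult_bound(2)[of "?n + K"] coeff_mult_bound(2)[of "?m + K"]; simp)+
      then show ?thesis
        using k Suc.prems by (simp add: w_def)
    qed
    then obtain r where r: "g - w - r \<in> poly_ideal {f1, f2}" "\<forall>k \<ge> ?m + ?n. coeff r k = 0"
      using Suc.IH[of "g - w"] by blast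
    have "g - r = (g - w - r) + w"
      by simp
    also have "\<dots> \<in> poly_ideal {f1, f2}"
      using r(1) w by (rule poly_ideal_add)
    finally show ?case
      using r(2) by blast
  qed
  from this[of "Suc (degree g)" g] show ?thesis
    by (simp add: coeff_eq_0)
qed

lemma card_quot_ring_eq_resultant:
  assumes fin: "finite (carrier (quot_ring {f1, f2}))"
  shows "int (card (carrier (quot_ring {f1, f2}))) = \<bar>resultant f1 f2\<bar>"
proof -
  let ?m = "degree f1" and ?n = "degree f2"
  let ?N = "?m + ?n" and ?I = "poly_ideal {f1, f2}"
  define L where "L = {g \<in> ?I. \<forall>k \<ge> ?N. coeff g k = 0}"
  have smult: "smult c g \<in> ?I" if "g \<in> ?I" for c g
    using poly_ideal_mult[OF that, of "[:c:]"] by simp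
  \<comment> \<open>Infinitely many integer multiples of x^k meet finitely many classes, so two of
    them are congruent.\<close>
  have full: "\<exists>c. c \<noteq> 0 \<and> monom c k \<in> ?I" for k
  proof -
    have "range (\<lambda>c. residue_class {f1, f2} (monom c k)) \<subseteq> carrier (quot_ring {f1, f2})"
      by (auto simp: carrier_quot_ring)
    then have "finite (range (\<lambda>c::int. residue_class {f1, f2} (monom c k)))"
      using fin finite_subset by blast
    then have "\<not> inj (\<lambda>c::int. residue_class {f1, f2} (monom c k))"
      using finite_imageD infinite_UNIV_int by blast
    then obtain c d where "c \<noteq> d" "monom c k - monom d k \<in> ?I"
      unfolding inj_def residue_class_eq_iff by blast
    then show ?thesis
      by (intro exI[of _ "c - d"]) (simp add: diff_monom)
  qed
  interpret full_poly_lattice L ?N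
  proof
    show "0 \<in> L"
      by (simp add: L_def poly_ideal_zero)
    show "g + h \<in> L" if "g \<in> L" "h \<in> L" for g h
      using that by (simp add: L_def poly_ideal_add)
    show "smult c g \<in> L" if "g \<in> L" for c g
      using that by (simp add: L_def smult)
    show "coeff g k = 0" if "g \<in> L" "k \<ge> ?N" for g k
      using that by (simp add: L_def)
    show "\<exists>c. c \<noteq> 0 \<and> monom c k \<in> L" if "k < ?N" for k
      using full[of k] that by (auto simp: L_def)
  qed
  \<comment> \<open>These are the rows of the Sylvester matrix: shifts of \<open>f1\<close>, then
    shifts of \<open>f2\<close>, each by descending powers.\<close>
  define q where "q i = (if i < ?n then monom 1 (?n - 1 - i) * f1 else monom 1 (?N - 1 - i) * f2)" for i
  have sylvester: "sylvester_mat f1 f2 = coeff_mat q"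
  proof (rule eq_matI)
    fix i j assume "i < dim_row (coeff_mat q)" "j < dim_col (coeff_mat q)"
    then have ij: "i < ?N" "j < ?N"
      by (simp_all add: coeff_mat_def)
    then show "sylvester_mat f1 f2 $$ (i, j) = coeff_mat q $$ (i, j)"
      by (auto simp: sylvester_index_mat coeff_mat_def q_def coeff_monom_mult
          intro: arg_cong2[of _ _ _ _ coeff] coeff_eq_0 sym[OF coeff_eq_0])
  qed (simp_all add: coeff_mat_def)
  have q: "q i \<in> L" if "i < ?N" for i
  proof -
    have "q i \<in> ?I"
      using generator_in_poly_ideal[of _ "{f1, f2}"] by (auto simp: q_def intro!: poly_ideal_mult)
    moreover have "coeff (q i) k = 0" if "k \<ge> ?N" for k
      using that \<open>i < ?N\<close> by (auto simp: q_def coeff_monom_mult intro: coeff_eq_0)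
    ultimately show ?thesis
      by (simp add: L_def)
  qed
  have span: "\<exists>c. g = (\<Sum>j<?N. smult (c j) (q j))" if "g \<in> L" for g
  proof -
    obtain u v where uv: "g = u * f1 + v * f2" "\<forall>k \<ge> ?n. coeff u k = 0" "\<forall>k \<ge> ?m. coeff v k = 0"
      using ideal_bounded_combination[of g] \<open>g \<in> L\<close> by (auto simp: L_def)
    \<comment> \<open>Descending order of powers matches the order of the rows
      \<open>q\<close>.\<close>
    have expand: "w = (\<Sum>i<d. smult (coeff w (d - Suc i)) (monom 1 (d - Suc i)))"
      if "\<forall>k \<ge> d. coeff w k = 0" for w :: "int poly" and d
    proof -
      have "w = (\<Sum>k<d. monom (coeff w k) k)"
        using that by (auto simp: poly_eq_iff coeff_sum)
      also have "\<dots> = (\<Sum>i<d. monom (coeff w (d - Suc i)) (d - Suc i))"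
        by (rule sum.nat_diff_reindex[symmetric])
      finally show ?thesis
        by (simp add: smult_monom)
    qed
    define c where "c j = (if j < ?n then coeff u (?n - Suc j) else coeff v (?N - Suc j))" for j
    have "u * f1 = (\<Sum>j<?n. smult (c j) (q j))"
      by (subst expand[OF uv(2)]) (simp add: sum_distrib_right c_def q_def)
    moreover have "v * f2 = (\<Sum>j<?m. smult (c (?n + j)) (q (?n + j)))"
      by (subst expand[OF uv(3)]) (simp add: sum_distrib_right c_def q_def)
    moreover have "(\<Sum>j<a + b. smult (c j) (q j))
        = (\<Sum>j<a. smult (c j) (q j)) + (\<Sum>j<b. smult (c (a + j)) (q (a + j)))" for a b
      by (induction b) (simp_all add: add.assoc)
    ultimately have "g = (\<Sum>j<?N. smult (c j) (q j))"
      using uv(1) by (simp add: add.commute[of ?m])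
    then show ?thesis
      by (rule exI[of _ c])
  qed
  have "int (card (residue_class {f1, f2} ` {g. \<forall>k \<ge> ?N. coeff g k = 0})) = \<bar>det (coeff_mat q)\<bar>"
    using q span by (intro card_quotient_eq_det) (auto simp: residue_class_eq_iff L_def)
  \<comment> \<open>By \<open>reduce_degree\<close> the bounded polynomials already represent every
    class.\<close>
  moreover have "residue_class {f1, f2} ` {g. \<forall>k \<ge> ?N. coeff g k = 0} = carrier (quot_ring {f1, f2})"
  proof -
    have "residue_class {f1, f2} g \<in> residue_class {f1, f2} ` {g. \<forall>k \<ge> ?N. coeff g k = 0}" for g
      using reduce_degree[of g] by (auto simp: residue_class_eq_iff[symmetric])
    then show ?thesis
      unfolding carrier_quot_ring by blast
  qed
  ultimately show ?thesis
    by (simp add: resultant_def sylvester)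
qed

end

theorem theorem3p11:
  shows
    "(\<forall>(f1 :: 'e::idom poly) f2 N1 N2 dt.
        shared_digits_setting f1 f2 N1 N2 dt \<longrightarrow>
          residue_class {f1, f2} dt \<in> Units (quot_ring {f1, f2}) \<and>
          S_period {f1, f2} (residue_class {f1, f2} dt) = card (carrier (quot_ring {f1, f2}))) \<and>
     (\<forall>(f1 :: int poly) f2 N1 N2 dt.
        shared_digits_setting f1 f2 N1 N2 dt \<and> coprime (lead_coeff f1) (lead_coeff f2) \<longrightarrow>
          int (S_period {f1, f2} (residue_class {f1, f2} dt)) = \<bar>resultant f1 f2\<bar> \<and>
          (\<forall>a. f1 = [:- a, 1:] \<longrightarrow>
             (\<forall>p. prime p \<and> p dvd poly f2 a \<longrightarrow> [a = 1] (mod p)) \<and>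
             (4 dvd poly f2 a \<longrightarrow> [a = 1] (mod 4))))"
proof (intro conjI allI impI)
  fix f1 f2 :: "'e poly" and N1 N2 dt
  assume *: "shared_digits_setting f1 f2 N1 N2 dt"
  from * show "residue_class {f1, f2} dt \<in> Units (quot_ring {f1, f2})"
    by (rule shared_digit_unit)
  from * show "S_period {f1, f2} (residue_class {f1, f2} dt) = card (carrier (quot_ring {f1, f2}))"
    by (rule S_period_eq_card)
next
  fix f1 f2 :: "int poly" and N1 N2 dt
  assume *: "shared_digits_setting f1 f2 N1 N2 dt \<and> coprime (lead_coeff f1) (lead_coeff f2)"
  then have "finite (carrier (quot_ring {f1, f2}))"
    by (simp add: shared_digits_setting_def)
  with * show "int (S_period {f1, f2} (residue_class {f1, f2} dt)) = \<bar>resultant f1 f2\<bar>"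
    using S_period_eq_card[of f1 f2 N1 N2 dt] by (simp add: card_quot_ring_eq_resultant)
next
  fix f1 f2 :: "int poly" and N1 N2 dt a p
  assume "shared_digits_setting f1 f2 N1 N2 dt \<and> coprime (lead_coeff f1) (lead_coeff f2)"
    "f1 = [:- a, 1:]" "prime p \<and> p dvd poly f2 a"
  then show "[a = 1] (mod p)"
    using cong_1_mod_prime by blast
next
  fix f1 f2 :: "int poly" and N1 N2 dt a
  assume "shared_digits_setting f1 f2 N1 N2 dt \<and> coprime (lead_coeff f1) (lead_coeff f2)"
    "f1 = [:- a, 1:]" "4 dvd poly f2 a"
  then show "[a = 1] (mod 4)"
    using cong_1_mod_4 by blast
qed

end
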